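(* Let $\langle X\mid R\rangle$ be a group presentation, where $R$ is a set of non-empty cyclically reduced words with $R^{-1}\subset R$. A relator of area $m$ has a contiguous subword equal to a proper g. corolla (proper generalized corolla) whose area is less than or equal to $m$. If the presentation is finite then there are finitely many such proper g. corollas.
   Context: Words are elements of the free monoid on $X\cup X^{-1}$; the free group $\mathcal F(X)$ is identified with the set of reduced words. A relator is a reduced word in the normal closure of $R$ in $\mathcal F(X)$. $\mathrm{Area}(w)$ is the least $k$ such that the relator $w$ is the reduced form of a product of $k$ conjugates of elements of $R$. A contiguous subword of $w$ is a word $v$ with $w=w'vw''$ for some words $w',w''$. A reduced word is cyclically reduced if its last letter is not the inverse of its first. For a word $u$ there are unique reduced $t$ and cyclically reduced $w$ such that the reduced form of $u$ is the word $twt^{-1}$; $w$ is the cyclically reduced form of $u$. $\pi(u,v)$ denotes the cyclically reduced form of $uv$. $w_2w_1$ is a cyclic conjugate of $w_1w_2$; $w_1uw_2$ is an insertion of $u$ into $w_1w_2$. Given a set $U$, a subset $B$ and a family $\Phi$ of operations on $U$, a straight line algorithm (SLA) is a finite sequence of steps, each of which is either an element of $B$ (a base step) or the application of an operation of $\Phi$ to outputs of distinct preceding steps, such that the output of every step except the last is an input of exactly one later step; its result is the output of the last step, and one says that it computes its result. An SLA in $\overline R$ is an SLA on the set of cyclically reduced words, with base set $R$ and with operations the cyclic conjugations and $\pi$, such that every step of the form $\pi(u,v)$ satisfies $\pi(u,v)\neq1$ and $|\pi(u,v)|<|u|+|v|$. The results of such SLA's are the g. corollas. For an SLA $\tau$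 in $\overline R$, $\eta(\tau)$ is the number of its base steps; for a g. corolla $c$, $\eta(c)$ is the minimum of $\eta(\tau)$ over the SLA's $\tau$ in $\overline R$ computing $c$. An SLA in $L_g$ is an SLA on the set of all words, whose base set consists of the words $vv^{-1}$ with $v$ reduced and non-empty together with all g. corollas, and whose operations are the insertions of words. For such an SLA $\sigma$, $A(\sigma)$ is the sum of $\eta(c)$ over the base steps $c$ of $\sigma$ that are g. corollas (counted with multiplicity). For a word $w$ that is the result of some SLA in $L_g$, $A(w)$ is the minimum of $A(\sigma)$ over the SLA's $\sigma$ in $L_g$ computing $w$. A proper g. corolla is a g. corolla $c$ with $A(c)=\eta(c)$.
   Formalization: The first claim is stated for non-empty relators only: the empty word is a relator of area 0, but every g. corolla is non-empty, so the claim fails for it. *)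

theory Defs
  imports "HOL-Algebra.Coset" "HOL-Library.Sublist"
begin

text \<open>The letter \<open>(x, True)\<close> stands for the generator \<open>x\<close>, and \<open>(x, False)\<close> for its
  formal inverse.\<close>

type_synonym 'a word = "('a \<times> bool) list"

definition words :: "'a set \<Rightarrow> 'a word set"
  where "words X = lists (X \<times> UNIV)"

fun inv_letter :: "'a \<times> bool \<Rightarrow> 'a \<times> bool"
  where "inv_letter (x, b) = (x, \<not> b)"

definition inv_word :: "'a word \<Rightarrow> 'a word"
  where "inv_word w = rev (map inv_letter w)"

definition reduced :: "'a word \<Rightarrow> bool"
  where "reduced w \<longleftrightarrow> successively (\<lambda>x y. y \<noteq> inv_letter x) w"

fun push_letter :: "'a \<times> bool \<Rightarrow> 'a word \<Rightarrow> 'a word"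
  where
    "push_letter x [] = [x]"
  | "push_letter x (y # w) = (if y = inv_letter x then w else x # y # w)"

text \<open>The reduced form of a word, computed by adding its letters from right to left and
  cancelling whenever possible.\<close>

definition red :: "'a word \<Rightarrow> 'a word"
  where "red w = foldr push_letter w []"

definition free_group :: "'a set \<Rightarrow> 'a word monoid"
  where "free_group X =
    \<lparr>carrier = {w \<in> words X. reduced w}, mult = (\<lambda>u v. red (u @ v)), one = []\<rparr>"

definition normal_closure :: "('g, 'b) monoid_scheme \<Rightarrow> 'g set \<Rightarrow> 'g set"
  where "normal_closure G S = \<Inter>{N. N \<lhd> G \<and> S \<subseteq> N}"

definition relator :: "'a set \<Rightarrow> 'a word set \<Rightarrow> 'a word \<Rightarrow> bool"
  where "relator X R w \<longleftrightarrow> w \<in> normal_closure (free_group X) R"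

text \<open>A pair \<open>(t, r)\<close> encodes the conjugate of \<open>r\<close> by \<open>t\<close>. The value is meaningful for
  relators only.\<close>

definition area :: "'a set \<Rightarrow> 'a word set \<Rightarrow> 'a word \<Rightarrow> nat"
  where "area X R w = (LEAST k. \<exists>ps. length ps = k \<and>
    (\<forall>(t, r) \<in> set ps. t \<in> carrier (free_group X) \<and> r \<in> R) \<and>
    w = red (concat (map (\<lambda>(t, r). t @ r @ inv_word t) ps)))"

text \<open>The empty word counts as cyclically reduced; otherwise the words with trivial reduced
  form would have no cyclically reduced form.\<close>

definition cyc_reduced :: "'a word \<Rightarrow> bool"
  where "cyc_reduced w \<longleftrightarrow> reduced w \<and> (w \<noteq> [] \<longrightarrow> last w \<noteq> inv_letter (hd w))"

definition cyc_red_form :: "'a word \<Rightarrow> 'a word"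
  where "cyc_red_form u =
    (THE w. cyc_reduced w \<and> (\<exists>t. reduced t \<and> red u = t @ w @ inv_word t))"

definition cyc_prod :: "'a word \<Rightarrow> 'a word \<Rightarrow> 'a word"
  where "cyc_prod u v = cyc_red_form (u @ v)"

text \<open>Operations are partial and take the list of their arguments, so that operations of
  different arities have a common type. A step carries its output; the numbers in an
  application are the positions of the steps whose outputs are the arguments.\<close>

type_synonym 'u operation = "'u list \<Rightarrow> 'u option"

datatype 'u step = Base (out_of: 'u) | Apply "'u operation" "nat list" (out_of: 'u)

fun inputs :: "'u step \<Rightarrow> nat list"
  where
    "inputs (Base b) = []"
  | "inputs (Apply f js out) = js"

definition sla :: "'u set \<Rightarrow> 'u set \<Rightarrow> 'u operation set \<Rightarrow> 'u step list \<Rightarrow> bool"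
  where "sla U B \<Phi> \<tau> \<longleftrightarrow> \<tau> \<noteq> [] \<and>
    (\<forall>i < length \<tau>. out_of (\<tau> ! i) \<in> U \<and>
      (case \<tau> ! i of
        Base b \<Rightarrow> b \<in> B
      | Apply f js out \<Rightarrow> f \<in> \<Phi> \<and> distinct js \<and> set js \<subseteq> {..<i} \<and>
          f (map (\<lambda>j. out_of (\<tau> ! j)) js) = Some out)) \<and>
    (\<forall>j < length \<tau> - 1. \<exists>!i. i < length \<tau> \<and> j \<in> set (inputs (\<tau> ! i)))"

definition result :: "'u step list \<Rightarrow> 'u"
  where "result \<tau> = out_of (last \<tau>)"

fun cyc_conj_op :: "nat \<Rightarrow> 'a word operation"
  where
    "cyc_conj_op n [w] = (if n \<le> length w then Some (drop n w @ take n w) else None)"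
  | "cyc_conj_op n _ = None"

fun cyc_prod_op :: "'a word operation"
  where
    "cyc_prod_op [u, v] = Some (cyc_prod u v)"
  | "cyc_prod_op _ = None"

fun insert_op :: "nat \<Rightarrow> 'a word operation"
  where
    "insert_op n [w, u] = (if n \<le> length w then Some (take n w @ u @ drop n w) else None)"
  | "insert_op n _ = None"

definition sla_Rbar :: "'a set \<Rightarrow> 'a word set \<Rightarrow> 'a word step list \<Rightarrow> bool"
  where "sla_Rbar X R \<tau> \<longleftrightarrow>
    sla {w \<in> words X. cyc_reduced w} R (insert cyc_prod_op (range cyc_conj_op)) \<tau> \<and>
    (\<forall>i < length \<tau>. \<forall>j k out. \<tau> ! i = Apply cyc_prod_op [j, k] out \<longrightarrow>
      out \<noteq> [] \<and> length out < length (out_of (\<tau> ! j)) + length (out_of (\<tau> ! k)))"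

definition g_corolla :: "'a set \<Rightarrow> 'a word set \<Rightarrow> 'a word \<Rightarrow> bool"
  where "g_corolla X R c \<longleftrightarrow> (\<exists>\<tau>. sla_Rbar X R \<tau> \<and> result \<tau> = c)"

definition eta_sla :: "'u step list \<Rightarrow> nat"
  where "eta_sla \<tau> = length (filter is_Base \<tau>)"

definition eta :: "'a set \<Rightarrow> 'a word set \<Rightarrow> 'a word \<Rightarrow> nat"
  where "eta X R c = (LEAST n. \<exists>\<tau>. sla_Rbar X R \<tau> \<and> result \<tau> = c \<and> eta_sla \<tau> = n)"

definition sla_Lg :: "'a set \<Rightarrow> 'a word set \<Rightarrow> 'a word step list \<Rightarrow> bool"
  where "sla_Lg X R \<sigma> \<longleftrightarrow>
    sla (words X)
      ({v @ inv_word v | v. v \<in> words X \<and> reduced v \<and> v \<noteq> []} \<union> {c. g_corolla X R c})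
      (range insert_op) \<sigma>"

definition A_sla :: "'a set \<Rightarrow> 'a word set \<Rightarrow> 'a word step list \<Rightarrow> nat"
  where "A_sla X R \<sigma> =
    (\<Sum>s \<leftarrow> filter (\<lambda>s. is_Base s \<and> g_corolla X R (out_of s)) \<sigma>. eta X R (out_of s))"

definition A_word :: "'a set \<Rightarrow> 'a word set \<Rightarrow> 'a word \<Rightarrow> nat"
  where "A_word X R w = (LEAST n. \<exists>\<sigma>. sla_Lg X R \<sigma> \<and> result \<sigma> = w \<and> A_sla X R \<sigma> = n)"

definition proper_g_corolla :: "'a set \<Rightarrow> 'a word set \<Rightarrow> 'a word \<Rightarrow> bool"
  where "proper_g_corolla X R c \<longleftrightarrow> g_corolla X R c \<and> A_word X R c = eta X R c"

lemma inv_letter_inv_letter [simp]: "inv_letter (inv_letter x) = x"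
  by (cases x) simp

lemma reduced_Nil [simp]: "reduced []"
  by (simp add: reduced_def)

lemma reduced_Cons: "reduced (x # w) \<longleftrightarrow> (w = [] \<or> hd w \<noteq> inv_letter x) \<and> reduced w"
  by (cases w) (auto simp: reduced_def)

lemma reduced_push_letter: "reduced w \<Longrightarrow> reduced (push_letter x w)"
  by (cases w) (auto simp: reduced_Cons)

lemma red_Nil [simp]: "red [] = []"
  by (simp add: red_def)

lemma red_Cons [simp]: "red (x # w) = push_letter x (red w)"
  by (simp add: red_def)

lemma reduced_red: "reduced (red w)"
  by (induction w) (auto simp: reduced_push_letter)

lemma red_reduced: "reduced w \<Longrightarrow> red w = w"
proof (induction w)
  case (Cons x w)
  then show ?case by (cases w) (auto simp: reduced_Cons)
qed simp

lemma push_letter_cancel: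
  assumes "reduced w"
  shows "push_letter x (push_letter (inv_letter x) w) = w"
  using assms by (cases w; cases "tl w") (auto simp: reduced_Cons)

lemma red_append_red: "red (u @ red v) = red (u @ v)"
  by (induction u) (auto simp: red_reduced reduced_red)

lemma red_push_letter_append: "red (push_letter x u @ v) = push_letter x (red (u @ v))"
proof (cases u)
  case (Cons y u')
  then show ?thesis using push_letter_cancel[OF reduced_red, of x "u' @ v"] by auto
qed simp

lemma red_red_append: "red (red u @ v) = red (u @ v)"
  by (induction u) (auto simp: red_push_letter_append)

lemma red_in_words: "w \<in> words X \<Longrightarrow> red w \<in> words X"
proof (induction w)
  case (Cons x w)
  then have "x \<in> X \<times> UNIV" "red w \<in> words X" by (auto simp: words_def)
  then show ?case by (cases "red w") (auto simp: words_def)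
qed simp

lemma inv_word_in_words: "w \<in> words X \<Longrightarrow> inv_word w \<in> words X"
  by (fastforce simp: words_def inv_word_def)

lemma red_inv_word_append: "red (inv_word w @ w) = []"
proof (induction w)
  case (Cons x w)
  have "red (inv_word (x # w) @ x # w) = red (inv_word w @ red (inv_letter x # x # w))"
    by (simp only: red_append_red) (simp add: inv_word_def)
  also have "red (inv_letter x # x # w) = red w"
    using push_letter_cancel[OF reduced_red, of "inv_letter x" w] by simp
  finally show ?case using Cons by (simp add: red_append_red)
qed (simp add: inv_word_def)

lemma group_free_group: "group (free_group X)"
proof (rule groupI)
  fix u assume "u \<in> carrier (free_group X)"
  then show "\<exists>v \<in> carrier (free_group X). v \<otimes>\<^bsub>free_group X\<^esub> u = \<one>\<^bsub>free_group X\<^esub>"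
    by (intro bexI[of _ "red (inv_word u)"])
      (auto simp: free_group_def red_red_append red_inv_word_append
        reduced_red red_in_words inv_word_in_words)
qed (auto simp: free_group_def red_red_append red_append_red red_reduced reduced_red
    intro!: red_in_words, auto simp: words_def)

end

theory Submission
  imports Defs
begin

text \<open>A product of \<open>m\<close> conjugates \<open>t r t\<^sup>-\<^sup>1\<close> is computed, as an unreduced word, by inserting each \<open>r\<close>
  into \<open>t t\<^sup>-\<^sup>1\<close>, so \<open>A \<le> m\<close> for this word. The point is that cancelling a factor \<open>x x\<^sup>-\<^sup>1\<close> does not
  increase \<open>A\<close>. If the two letters come from different base words then, up to cyclic
  conjugation, these are \<open>b x\<close> and \<open>x\<^sup>-\<^sup>1 d\<close>; their product \<open>\<pi>\<close> is shorter than the sum of the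
  lengths, hence a g. corolla or trivial, and \<open>b d\<close> arises from it by inserting words \<open>v v\<^sup>-\<^sup>1\<close>.
  So \<open>A(w) \<le> Area(w)\<close> for every relator \<open>w \<noteq> 1\<close>. In a computation of \<open>w\<close> that attains \<open>A(w)\<close>,
  some base word is a contiguous subword of \<open>w\<close>; it is reduced, hence a g. corolla \<open>c\<close>, it is
  proper by minimality, and \<open>Area(c) \<le> \<eta>(c) \<le> A(w)\<close>. Finally, a proper g. corolla of area at
  most \<open>m\<close> has \<open>\<eta>(c) = A(c) \<le> m\<close>, which bounds its length.\<close>

section \<open>Reduced and cyclically reduced forms\<close>

lemma inv_word_Nil [simp]: "inv_word [] = []"
  by (simp add: inv_word_def)

lemma inv_word_Cons: "inv_word (x # w) = inv_word w @ [inv_letter x]"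
  by (simp add: inv_word_def)

lemma inv_word_append [simp]: "inv_word (u @ v) = inv_word v @ inv_word u"
  by (simp add: inv_word_def)

lemma inv_word_inv_word [simp]: "inv_word (inv_word w) = w"
  by (simp add: inv_word_def rev_map comp_def)

lemma inv_letter_neq [simp]: "inv_letter x \<noteq> x" "x \<noteq> inv_letter x"
  by (cases x; simp)+

lemma inv_letter_eq_iff: "inv_letter x = y \<longleftrightarrow> x = inv_letter y"
  by auto

lemma words_append [simp]: "u @ v \<in> words X \<longleftrightarrow> u \<in> words X \<and> v \<in> words X"
  by (auto simp: words_def)

lemma words_Cons [simp]: "x # v \<in> words X \<longleftrightarrow> fst x \<in> X \<and> v \<in> words X"
  by (cases x) (auto simp: words_def)

lemma words_Nil [simp]: "[] \<in> words X"
  by (simp add: words_def)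

lemma fst_inv_letter [simp]: "fst (inv_letter x) = fst x"
  by (cases x) simp

lemma reduced_append:
  "reduced (u @ v) \<longleftrightarrow>
     reduced u \<and> reduced v \<and> (u \<noteq> [] \<longrightarrow> v \<noteq> [] \<longrightarrow> hd v \<noteq> inv_letter (last u))"
  by (auto simp: reduced_def successively_append_iff)

lemma red_red [simp]: "red (red w) = red w"
  by (simp add: red_reduced reduced_red)

text \<open>Makes identities of the free group provable by replacing subwords, without analysing
  where letters cancel.\<close>

lemma red_append_cong:
  assumes "red a = red a'" "red b = red b'"
  shows "red (a @ b) = red (a' @ b')"
  by (metis assms red_append_red red_red_append)

lemma red_append_inv_word: "red (w @ inv_word w) = []"
  using red_inv_word_append[of "inv_word w"] by simp

lemma red_cancel_inv: "red (inv_word w @ w @ u) = red u" "red (w @ inv_word w @ u) = red u"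
  using red_append_cong[of "inv_word w @ w" "[]" u u] red_append_cong[of "w @ inv_word w" "[]" u u]
  by (auto simp: red_append_inv_word red_inv_word_append)

lemma red_inv_word_cong:
  assumes "red u = red v"
  shows "red (inv_word u) = red (inv_word v)"
proof -
  have "red (inv_word u) = red (inv_word u @ v @ inv_word v)"
    using red_append_cong[of "inv_word u" "inv_word u" "v @ inv_word v" "[]"]
    by (simp add: red_append_inv_word)
  also have "\<dots> = red (inv_word u @ u @ inv_word v)"
    by (intro red_append_cong assms[symmetric] refl)
  finally show ?thesis by (simp add: red_cancel_inv)
qed

lemma cyc_reduced_rotate:
  assumes "cyc_reduced (u @ v)"
  shows "cyc_reduced (v @ u)"
  using assms
  by (cases "u = []"; cases "v = []") (auto simp: cyc_reduced_def reduced_append inv_letter_eq_iff)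

text \<open>A reduced word that is not cyclically reduced starts with some \<open>x\<close> and ends
  with its inverse; stripping both leaves a shorter reduced word, whose conjugator is then extended
  by \<open>x\<close>.\<close>

lemma cyc_red_form_exists:
  assumes "reduced u"
  shows "\<exists>w t. cyc_reduced w \<and> reduced t \<and> u = t @ w @ inv_word t"
  using assms
proof (induction u rule: length_induct)
  case (1 u)
  show ?case
  proof (cases "cyc_reduced u")
    case True
    then show ?thesis by (intro exI[of _ u] exI[of _ "[]"]) auto
  next
    case False
    with 1(2) obtain x z where u: "u = x # z" "last u = inv_letter x"
      by (cases u) (auto simp: cyc_reduced_def)
    \<comment> \<open>Otherwise \<open>x\<close> would be its own inverse.\<close>
    then have "z \<noteq> []" by auto
    then obtain v where z: "z = v @ [inv_letter x]"
      using u by (metis append_butlast_last_id last_ConsR)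
    then have "reduced v" using 1(2) u by (auto simp: reduced_append reduced_Cons)
    moreover have "length v < length u" using u z by simp
    ultimately obtain w t where wt: "cyc_reduced w" "reduced t" "v = t @ w @ inv_word t"
      using 1(1) by blast
    have eq: "u = (x # t) @ w @ inv_word (x # t)" using u z wt by (simp add: inv_word_Cons)
    then have "reduced (x # t)" using 1(2) by (auto simp only: reduced_append)
    with eq wt show ?thesis by blast
  qed
qed

lemma cyc_reduced_conj_eq_Nil:
  assumes "cyc_reduced (s @ v @ inv_word s)"
  shows "s = []"
  using assms by (cases s) (auto simp: cyc_reduced_def inv_word_Cons)

text \<open>Both conjugators are prefixes of the same word, so the longer one is the shorter
  followed by some \<open>y\<close>. One core is then the conjugate of the other by
  \<open>y\<close>, which forces \<open>y\<close> to be empty.\<close>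

lemma cyc_red_form_unique:
  assumes "cyc_reduced w" "cyc_reduced v" "t @ w @ inv_word t = s @ v @ inv_word s"
  shows "w = v"
proof -
  have *: "w = v" if cw: "cyc_reduced w" and eq: "t @ w @ inv_word t = s @ v @ inv_word s"
    and le: "length t \<le> length s" for w v t s :: "'a word"
  proof -
    obtain y where s: "s = t @ y"
      using eq le by (metis append_eq_append_conv_if append_take_drop_id)
    then have "w = y @ v @ inv_word y" using eq by simp
    then show ?thesis using cyc_reduced_conj_eq_Nil[of y v] cw by auto
  qed
  show ?thesis using *[of w t s v] *[of v s t w] assms by (cases "length t \<le> length s") auto
qed

lemma cyc_red_form_props:
  shows "cyc_reduced (cyc_red_form u)"
    and "\<exists>t. reduced t \<and> red u = t @ cyc_red_form u @ inv_word t"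
proof -
  have "\<exists>!w. cyc_reduced w \<and> (\<exists>t. reduced t \<and> red u = t @ w @ inv_word t)"
    using cyc_red_form_exists[OF reduced_red, of u] cyc_red_form_unique by metis
  from theI'[OF this] show "cyc_reduced (cyc_red_form u)"
    and "\<exists>t. reduced t \<and> red u = t @ cyc_red_form u @ inv_word t"
    by (simp_all add: cyc_red_form_def)
qed

lemma cyc_red_form_in_words:
  assumes "u \<in> words X"
  shows "cyc_red_form u \<in> words X"
  using cyc_red_form_props(2)[of u] red_in_words[OF assms] by auto

lemma length_push_letter: "length (push_letter x w) \<le> Suc (length w)"
  by (cases w) auto

lemma length_red: "length (red w) \<le> length w"
proof (induction w)
  case (Cons x w)
  then show ?case using length_push_letter[of x "red w"] by simp
qed simp

section \<open>Straight line algorithms as trees\<close>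

text \<open>Every output is used at most once, so the costs of the outputs not yet used always add up
  to the cost of the base steps done so far.\<close>

lemma sla_cost_induct:
  fixes c :: "'u \<Rightarrow> nat"
  assumes sla: "sla U B \<Phi> \<tau>"
    and base: "\<And>b. b \<in> B \<Longrightarrow> P b (c b)"
    and app: "\<And>i f js out g. i < length \<tau> \<Longrightarrow> \<tau> ! i = Apply f js out \<Longrightarrow>
      (\<And>j. j \<in> set js \<Longrightarrow> P (out_of (\<tau> ! j)) (g j)) \<Longrightarrow> P out (sum g (set js))"
  shows "P (result \<tau>) (\<Sum>s\<leftarrow>filter is_Base \<tau>. c (out_of s))"
proof -
  \<comment> \<open>The outputs not consumed before step \<open>k\<close>: the roots of the forest
    built so far.\<close>
  define live where "live k = {j. j < k \<and> (\<forall>i<k. j \<notin> set (inputs (\<tau> ! i)))}" for k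
  have fin: "finite (live k)" for k by (simp add: live_def)
  have inp: "set (inputs (\<tau> ! i)) \<subseteq> {..<i}" if "i < length \<tau>" for i
    using sla that by (cases "\<tau> ! i") (fastforce simp: sla_def)+
  have uniq: "\<exists>!i. i < length \<tau> \<and> j \<in> set (inputs (\<tau> ! i))" if "j < length \<tau> - 1" for j
    using sla that by (simp add: sla_def)
  have "\<exists>g. (\<forall>i<k. P (out_of (\<tau> ! i)) (g i)) \<and>
      sum g (live k) = (\<Sum>s\<leftarrow>filter is_Base (take k \<tau>). c (out_of s))" if "k \<le> length \<tau>" for k
    using that
  proof (induction k)
    case 0
    then show ?case by (simp add: live_def)
  next
    case (Suc k)
    then obtain g where g: "\<And>i. i < k \<Longrightarrow> P (out_of (\<tau> ! i)) (g i)"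
      "sum g (live k) = (\<Sum>s\<leftarrow>filter is_Base (take k \<tau>). c (out_of s))" by auto
    have k: "k < length \<tau>" using Suc by simp
    have notin: "k \<notin> set (inputs (\<tau> ! i))" if "i \<le> k" for i
      using inp[of i] that k by auto
    have live_Suc: "live (Suc k) = insert k (live k - set (inputs (\<tau> ! k)))"
      using notin by (auto simp: live_def less_Suc_eq)
    have k_live: "k \<notin> live k" by (simp add: live_def)
    \<comment> \<open>Each output has only one consumer, so an input of step \<open>k\<close> has
      not been consumed before.\<close>
    have sub: "set (inputs (\<tau> ! k)) \<subseteq> live k"
    proof
      fix j assume j: "j \<in> set (inputs (\<tau> ! k))"
      then have "j < k" using inp[OF k] by auto
      moreover have "i = k" if "i < k" "j \<in> set (inputs (\<tau> ! i))" for i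
        using uniq[of j] \<open>j < k\<close> k j that by (metis less_trans less_diff_conv Suc_eq_plus1 Suc_lessI not_less_eq)
      ultimately show "j \<in> live k" by (auto simp: live_def)
    qed
    have take: "take (Suc k) \<tau> = take k \<tau> @ [\<tau> ! k]" using k by (rule take_Suc_conv_app_nth)
    have sum_upd: "sum (g(k := a)) (live (Suc k)) =
        a + sum g (live k - set (inputs (\<tau> ! k)))" for a
      unfolding live_Suc using fin k_live
      by (subst sum.insert) (auto intro!: sum.cong)
    show ?case
    proof (cases "\<tau> ! k")
      case (Base b)
      then have "b \<in> B" using sla k by (auto simp: sla_def split: step.splits)
      then show ?thesis using g base Base sum_upd[of "c b"]
        by (intro exI[of _ "g(k := c b)"]) (auto simp: take less_Suc_eq)
    next
      case (Apply f js out)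
      have "P out (sum g (set js))"
        using inp[OF k] Apply g(1) by (intro app[OF k Apply]) auto
      moreover have "sum g (set js) + sum g (live k - set js) = sum g (live k)"
        using sub Apply fin by (simp add: sum.subset_diff[of "set js" "live k"] add.commute)
      ultimately show ?thesis using g Apply sum_upd[of "sum g (set js)"]
        by (intro exI[of _ "g(k := sum g (set js))"]) (auto simp: take less_Suc_eq)
    qed
  qed
  then obtain g where g: "\<forall>i<length \<tau>. P (out_of (\<tau> ! i)) (g i)"
    "sum g (live (length \<tau>)) = (\<Sum>s\<leftarrow>filter is_Base \<tau>. c (out_of s))"
    by (metis order_refl take_all)
  have ne: "\<tau> \<noteq> []" using sla by (simp add: sla_def)
  have "live (length \<tau>) = {length \<tau> - 1}"
  proof (intro equalityI subsetI)
    fix j assume "j \<in> live (length \<tau>)"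
    then have j: "j < length \<tau>" "\<And>i. i < length \<tau> \<Longrightarrow> j \<notin> set (inputs (\<tau> ! i))"
      by (auto simp: live_def)
    then have "\<not> j < length \<tau> - 1" using uniq by blast
    then show "j \<in> {length \<tau> - 1}" using j(1) by simp
  next
    fix j assume "j \<in> {length \<tau> - 1}"
    then have j: "j = length \<tau> - 1" by simp
    have "j \<notin> set (inputs (\<tau> ! i))" if "i < length \<tau>" for i
      using inp[OF that] that j by auto
    then show "j \<in> live (length \<tau>)" using ne j by (simp add: live_def)
  qed
  then have "g (length \<tau> - 1) = (\<Sum>s\<leftarrow>filter is_Base \<tau>. c (out_of s))" using g(2) by simp
  moreover have "length \<tau> - 1 < length \<tau>" using ne by simp
  ultimately show ?thesis using g(1) ne by (metis result_def last_conv_nth)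
qed

section \<open>Composing straight line algorithms\<close>

fun shift_step :: "nat \<Rightarrow> 'u step \<Rightarrow> 'u step"
  where
    "shift_step k (Base b) = Base b"
  | "shift_step k (Apply f js out) = Apply f (map ((+) k) js) out"

lemma out_of_shift_step [simp]: "out_of (shift_step k s) = out_of s"
  by (cases s) auto

lemma is_Base_shift_step [simp]: "is_Base (shift_step k s) = is_Base s"
  by (cases s) auto

lemma inputs_shift_step [simp]: "inputs (shift_step k s) = map ((+) k) (inputs s)"
  by (cases s) auto

text \<open>Validity of a step consults only this step and earlier ones, so it survives appending
  and shifting; the condition on the use of outputs is global and is treated separately.\<close>

definition valid_step :: "'u set \<Rightarrow> 'u set \<Rightarrow> 'u operation set \<Rightarrow> 'u step list \<Rightarrow> nat \<Rightarrow> bool"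
  where "valid_step U B \<Phi> \<tau> i \<longleftrightarrow> out_of (\<tau> ! i) \<in> U \<and>
      (case \<tau> ! i of
        Base b \<Rightarrow> b \<in> B
      | Apply f js out \<Rightarrow> f \<in> \<Phi> \<and> distinct js \<and> set js \<subseteq> {..<i} \<and>
          f (map (\<lambda>j. out_of (\<tau> ! j)) js) = Some out)"

lemma sla_iff: "sla U B \<Phi> \<tau> \<longleftrightarrow> \<tau> \<noteq> [] \<and> (\<forall>i < length \<tau>. valid_step U B \<Phi> \<tau> i) \<and>
    (\<forall>j < length \<tau> - 1. \<exists>!i. i < length \<tau> \<and> j \<in> set (inputs (\<tau> ! i)))"
  by (simp add: sla_def valid_step_def)

lemma valid_step_append:
  assumes "valid_step U B \<Phi> \<tau> i" "i < length \<tau>"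
  shows "valid_step U B \<Phi> (\<tau> @ \<tau>') i"
proof -
  have "map (\<lambda>j. out_of ((\<tau> @ \<tau>') ! j)) js = map (\<lambda>j. out_of (\<tau> ! j)) js"
    if "set js \<subseteq> {..<i}" for js
    using that assms(2) by (auto simp: nth_append)
  moreover have "(\<tau> @ \<tau>') ! i = \<tau> ! i" using assms(2) by (simp add: nth_append)
  ultimately show ?thesis using assms unfolding valid_step_def
    by (simp split: step.splits del: map_eq_conv)
qed

lemma valid_step_shift:
  assumes "valid_step U B \<Phi> \<tau> i" "i < length \<tau>"
  shows "valid_step U B \<Phi> (\<tau>' @ map (shift_step (length \<tau>')) \<tau>) (length \<tau>' + i)"
proof -
  have "map ((\<lambda>j. out_of ((\<tau>' @ map (shift_step (length \<tau>')) \<tau>) ! j)) \<circ> (+) (length \<tau>')) js =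
      map (\<lambda>j. out_of (\<tau> ! j)) js" if "set js \<subseteq> {..<i}" for js
    using that assms(2) by (auto simp: nth_append)
  moreover have "(\<tau>' @ map (shift_step (length \<tau>')) \<tau>) ! (length \<tau>' + i) =
      shift_step (length \<tau>') (\<tau> ! i)"
    using assms(2) by (simp add: nth_append)
  ultimately show ?thesis using assms unfolding valid_step_def
    by (cases "\<tau> ! i") (auto simp: distinct_map inj_on_def simp del: map_eq_conv)
qed

lemma sla_inputs:
  assumes "sla U B \<Phi> \<tau>" "i < length \<tau>" "j \<in> set (inputs (\<tau> ! i))"
  shows "j < i"
  using assms by (cases "\<tau> ! i") (fastforce simp: sla_iff valid_step_def)+

lemma sla_Base: "b \<in> U \<Longrightarrow> b \<in> B \<Longrightarrow> sla U B \<Phi> [Base b]"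
  by (simp add: sla_def)

text \<open>The old result was the only output without a consumer; the new step consumes it and
  takes over its role.\<close>

lemma sla_Apply1:
  assumes sla: "sla U B \<Phi> \<tau>" and f: "f \<in> \<Phi>" "f [result \<tau>] = Some out" "out \<in> U"
  shows "sla U B \<Phi> (\<tau> @ [Apply f [length \<tau> - 1] out])" (is "sla U B \<Phi> ?\<tau>")
proof -
  have ne: "\<tau> \<noteq> []" using sla by (simp add: sla_iff)
  have "valid_step U B \<Phi> ?\<tau> i" if "i < length ?\<tau>" for i
  proof (cases "i < length \<tau>")
    case True
    then show ?thesis using sla by (intro valid_step_append) (auto simp: sla_iff)
  next
    case False
    then have "i = length \<tau>" using that by simp
    then show ?thesis using f ne by (simp add: valid_step_def nth_append result_def last_conv_nth)
  qed
  moreover have "\<exists>!i. i < length ?\<tau> \<and> j \<in> set (inputs (?\<tau> ! i))" if j: "j < length ?\<tau> - 1" for j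
  proof (cases "j = length \<tau> - 1")
    case True
    show ?thesis
    proof (rule ex1I[of _ "length \<tau>"])
      show "i = length \<tau>" if "i < length ?\<tau> \<and> j \<in> set (inputs (?\<tau> ! i))" for i
        using that sla_inputs[OF sla, of i j] True
        by (cases "i < length \<tau>") (auto simp: nth_append)
    qed (use True in auto)
  next
    case False
    then have "\<exists>!i. i < length \<tau> \<and> j \<in> set (inputs (\<tau> ! i))"
      using sla j unfolding sla_iff by auto
    then obtain i where i: "i < length \<tau>" "j \<in> set (inputs (\<tau> ! i))"
      "\<And>i'. i' < length \<tau> \<Longrightarrow> j \<in> set (inputs (\<tau> ! i')) \<Longrightarrow> i' = i" by blast
    show ?thesis
    proof (rule ex1I[of _ i])
      show "i' = i" if "i' < length ?\<tau> \<and> j \<in> set (inputs (?\<tau> ! i'))" for i'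
        using that i(1,2) i(3)[of i'] False by (cases "i' < length \<tau>") (auto simp: nth_append)
    qed (use i(1,2) in \<open>auto simp: nth_append\<close>)
  qed
  ultimately show ?thesis by (simp add: sla_iff)
qed

text \<open>The two computations stay disjoint even if they compute the same word, since no output
  may serve two steps and the inputs of a step are distinct positions.\<close>

definition join_sla :: "'u operation \<Rightarrow> 'u \<Rightarrow> 'u step list \<Rightarrow> 'u step list \<Rightarrow> 'u step list"
  where "join_sla f out \<tau> \<tau>' = \<tau> @ map (shift_step (length \<tau>)) \<tau>' @
    [Apply f [length \<tau> - 1, length \<tau> + length \<tau>' - 1] out]"

lemma nth_join_sla:
  "i < length \<tau> \<Longrightarrow> join_sla f out \<tau> \<tau>' ! i = \<tau> ! i"
  "i < length \<tau>' \<Longrightarrow> join_sla f out \<tau> \<tau>' ! (length \<tau> + i) = shift_step (length \<tau>) (\<tau>' ! i)"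
  "join_sla f out \<tau> \<tau>' ! (length \<tau> + length \<tau>') =
     Apply f [length \<tau> - 1, length \<tau> + length \<tau>' - 1] out"
  by (simp_all add: join_sla_def nth_append)

lemma length_join_sla [simp]: "length (join_sla f out \<tau> \<tau>') = Suc (length \<tau> + length \<tau>')"
  by (simp add: join_sla_def)

lemma result_join_sla [simp]: "result (join_sla f out \<tau> \<tau>') = out"
  by (simp add: join_sla_def result_def)

lemma join_sla_cases:
  assumes "i < length (join_sla f out \<tau> \<tau>')"
  obtains "i < length \<tau>" | k where "k < length \<tau>'" "i = length \<tau> + k" | "i = length \<tau> + length \<tau>'"
proof -
  consider "i < length \<tau>" | "length \<tau> \<le> i" "i < length \<tau> + length \<tau>'" | "i = length \<tau> + length \<tau>'"
    using assms by fastforce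
  then show ?thesis
  proof cases
    case 2
    then show ?thesis using that(2)[of "i - length \<tau>"] by simp
  qed (use that in auto)
qed

lemma sla_join_sla:
  assumes sla: "sla U B \<Phi> \<tau>" and sla': "sla U B \<Phi> \<tau>'"
    and f: "f \<in> \<Phi>" "f [result \<tau>, result \<tau>'] = Some out" "out \<in> U"
  shows "sla U B \<Phi> (join_sla f out \<tau> \<tau>')" (is "sla U B \<Phi> ?\<tau>")
proof -
  let ?n = "length \<tau>" and ?n' = "length \<tau>'"
  have ne: "\<tau> \<noteq> []" "\<tau>' \<noteq> []" using sla sla' by (simp_all add: sla_iff)
  then have pos: "0 < ?n" "0 < ?n'" by auto
  have valid: "valid_step U B \<Phi> ?\<tau> i" if "i < length ?\<tau>" for i
    using that
  proof (cases rule: join_sla_cases)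
    case 1
    then show ?thesis using sla unfolding join_sla_def
      by (intro valid_step_append) (auto simp: sla_iff)
  next
    case (2 k)
    then have "valid_step U B \<Phi> (\<tau> @ map (shift_step ?n) \<tau>') i"
      using sla' by (auto simp: sla_iff intro!: valid_step_shift)
    then show ?thesis using 2 valid_step_append[of U B \<Phi> "\<tau> @ map (shift_step ?n) \<tau>'" i]
      by (auto simp: join_sla_def)
  next
    case 3
    have last: "?\<tau> ! (?n - 1) = last \<tau>"
      "?\<tau> ! (?n + ?n' - 1) = shift_step ?n (last \<tau>')"
      using nth_join_sla(1)[of "?n - 1" \<tau>] nth_join_sla(2)[of "?n' - 1" \<tau>' f out \<tau>] ne pos
      by (auto simp: last_conv_nth)
    have "?n - 1 \<noteq> ?n + ?n' - 1" "?n - 1 < ?n + ?n'" "?n + ?n' - 1 < ?n + ?n'"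
      using pos by linarith+
    then show ?thesis using f unfolding 3 valid_step_def nth_join_sla(3)
      by (simp add: last result_def del: One_nat_def)
  qed
  have uniq: "\<exists>!i. i < length ?\<tau> \<and> j \<in> set (inputs (?\<tau> ! i))" if j: "j < length ?\<tau> - 1" for j
  proof -
    \<comment> \<open>The last positions of the two blocks are consumed by the new step; every other
      position keeps its consumer, shifted in the second block.\<close>
    consider "j < ?n - 1" | "j = ?n - 1" | k where "k < ?n' - 1" "j = ?n + k" | "j = ?n + ?n' - 1"
    proof -
      have "j < ?n - 1 \<or> j = ?n - 1 \<or> (j - ?n < ?n' - 1 \<and> j = ?n + (j - ?n)) \<or> j = ?n + ?n' - 1"
        using j pos by auto
      then show ?thesis using that by blast
    qed
    then show ?thesis
    proof cases
      case 1
      then obtain i where i: "i < ?n" "j \<in> set (inputs (\<tau> ! i))"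
        "\<And>i'. i' < ?n \<Longrightarrow> j \<in> set (inputs (\<tau> ! i')) \<Longrightarrow> i' = i"
        using sla unfolding sla_iff by blast
      show ?thesis
      proof (rule ex1I[of _ i])
        fix i' assume "i' < length ?\<tau> \<and> j \<in> set (inputs (?\<tau> ! i'))"
        then have "i' < length ?\<tau>" and *: "j \<in> set (inputs (?\<tau> ! i'))" by auto
        from this(1) show "i' = i"
          by (cases rule: join_sla_cases) (use * i(1,2) i(3)[of i'] 1 pos in \<open>auto simp: nth_join_sla\<close>)
      qed (use i(1,2) in \<open>auto simp: nth_join_sla\<close>)
    next
      case 2
      show ?thesis
      proof (rule ex1I[of _ "?n + ?n'"])
        fix i' assume "i' < length ?\<tau> \<and> j \<in> set (inputs (?\<tau> ! i'))"
        then have "i' < length ?\<tau>" and *: "j \<in> set (inputs (?\<tau> ! i'))" by auto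
        from this(1) show "i' = ?n + ?n'"
        proof (cases rule: join_sla_cases)
          case 1
          then show ?thesis using * 2 sla_inputs[OF sla 1, of j] by (simp add: nth_join_sla)
        next
          case (2 k)
          then have "?n \<le> j" using * by (auto simp: nth_join_sla)
          then show ?thesis using \<open>j = ?n - 1\<close> pos by linarith
        qed
      qed (use 2 in \<open>auto simp: nth_join_sla\<close>)
    next
      case (3 k)
      then obtain i where i: "i < ?n'" "k \<in> set (inputs (\<tau>' ! i))"
        "\<And>i'. i' < ?n' \<Longrightarrow> k \<in> set (inputs (\<tau>' ! i')) \<Longrightarrow> i' = i"
        using sla' unfolding sla_iff by blast
      show ?thesis
      proof (rule ex1I[of _ "?n + i"])
        fix i' assume "i' < length ?\<tau> \<and> j \<in> set (inputs (?\<tau> ! i'))"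
        then have "i' < length ?\<tau>" and *: "j \<in> set (inputs (?\<tau> ! i'))" by auto
        from this(1) show "i' = ?n + i"
        proof (cases rule: join_sla_cases)
          case (2 k')
          then show ?thesis using * i(3)[of k'] 3 by (auto simp: nth_join_sla)
        next
          case 1
          then have "j < ?n" using * sla_inputs[OF sla 1, of j] by (simp add: nth_join_sla)
          then show ?thesis using \<open>j = ?n + k\<close> by linarith
        next
          assume "i' = ?n + ?n'"
          then have "j = ?n - 1 \<or> j = ?n + ?n' - 1" using * by (simp add: nth_join_sla(3))
          then show ?thesis using \<open>j = ?n + k\<close> \<open>k < ?n' - 1\<close> pos by linarith
        qed
      qed (use i(1,2) 3 in \<open>auto simp: nth_join_sla\<close>)
    next
      case 4
      show ?thesis
      proof (rule ex1I[of _ "?n + ?n'"])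
        fix i' assume "i' < length ?\<tau> \<and> j \<in> set (inputs (?\<tau> ! i'))"
        then have "i' < length ?\<tau>" and *: "j \<in> set (inputs (?\<tau> ! i'))" by auto
        from this(1) show "i' = ?n + ?n'"
        proof (cases rule: join_sla_cases)
          case 1
          then have "j < ?n" using * sla_inputs[OF sla 1, of j] by (simp add: nth_join_sla)
          then show ?thesis using 4 pos by linarith
        next
          case (2 k)
          then obtain j' where "j = ?n + j'" "j' \<in> set (inputs (\<tau>' ! k))"
            using * by (auto simp: nth_join_sla)
          then show ?thesis using 4 2(1) sla_inputs[OF sla' 2(1), of j'] by linarith
        qed
      qed (use 4 in \<open>auto simp: nth_join_sla\<close>)
    qed
  qed
  have "?\<tau> \<noteq> []" by (simp add: join_sla_def)
  with valid uniq show ?thesis unfolding sla_iff by blast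
qed

section \<open>Costs of corollas and of insertions\<close>

locale symmetric_presentation =
  fixes X :: "'a set" and R :: "'a word set"
  assumes R_words: "R \<subseteq> words X"
    and R_cyc: "\<forall>r \<in> R. r \<noteq> [] \<and> cyc_reduced r"
    and R_inv: "inv_word ` R \<subseteq> R"
begin

text \<open>As every output is used once, an SLA is a tree, and these rules generate the trees:
  \<open>corolla_cost c n\<close> holds iff an SLA in the sense of \<open>sla_Rbar\<close> with
  \<open>n\<close> base steps computes \<open>c\<close>.\<close>

inductive corolla_cost :: "'a word \<Rightarrow> nat \<Rightarrow> bool"
  where
    base: "r \<in> R \<Longrightarrow> corolla_cost r 1"
  | rotate: "corolla_cost (u @ v) n \<Longrightarrow> corolla_cost (v @ u) n"
  | prod: "corolla_cost u m \<Longrightarrow> corolla_cost v n \<Longrightarrow> cyc_prod u v \<noteq> [] \<Longrightarrow>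
      length (cyc_prod u v) < length u + length v \<Longrightarrow> corolla_cost (cyc_prod u v) (m + n)"

lemma corolla_cost_props:
  assumes "corolla_cost c n"
  shows "c \<in> words X" "c \<noteq> []" "cyc_reduced c"
proof -
  have "c \<in> words X \<and> c \<noteq> [] \<and> cyc_reduced c" using assms
  proof induction
    case (base r)
    then show ?case using R_words R_cyc by auto
  next
    case (rotate u v n)
    then show ?case using cyc_reduced_rotate[of u v] by auto
  next
    case (prod u m v n)
    then show ?case
      using cyc_red_form_in_words[of "u @ v" X] cyc_red_form_props(1)[of "u @ v"]
      by (simp add: cyc_prod_def)
  qed
  then show "c \<in> words X" "c \<noteq> []" "cyc_reduced c" by auto
qed

lemma corolla_cost_of_sla:
  assumes "sla_Rbar X R \<tau>"
  shows "corolla_cost (result \<tau>) (eta_sla \<tau>)"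
proof -
  have sla: "sla {w \<in> words X. cyc_reduced w} R (insert cyc_prod_op (range cyc_conj_op)) \<tau>"
    using assms by (simp add: sla_Rbar_def)
  have "corolla_cost (result \<tau>) (\<Sum>s\<leftarrow>filter is_Base \<tau>. 1)"
    using sla
  proof (rule sla_cost_induct)
    fix i f js out g
    assume i: "i < length \<tau>" "\<tau> ! i = Apply f js out"
      and g: "\<And>j. j \<in> set js \<Longrightarrow> corolla_cost (out_of (\<tau> ! j)) (g j)"
    from sla i have f: "f \<in> insert cyc_prod_op (range cyc_conj_op)"
      and js: "distinct js" and out: "f (map (\<lambda>j. out_of (\<tau> ! j)) js) = Some out"
      by (auto simp: sla_def split: step.splits)
    show "corolla_cost out (sum g (set js))"
    proof (cases "f = cyc_prod_op")
      case True
      \<comment> \<open>The operation is defined on two arguments only; their positions are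
        distinct, so the costs add.\<close>
      with out obtain j k where jk: "js = [j, k]"
        by (auto elim!: cyc_prod_op.elims)
      with True out have o: "out = cyc_prod (out_of (\<tau> ! j)) (out_of (\<tau> ! k))" by simp
      have "out \<noteq> []" "length out < length (out_of (\<tau> ! j)) + length (out_of (\<tau> ! k))"
        using assms i True jk by (auto simp: sla_Rbar_def)
      then show ?thesis
        using prod[of "out_of (\<tau> ! j)" "g j" "out_of (\<tau> ! k)" "g k"] g js jk o by simp
    next
      case False
      with f obtain n where n: "f = cyc_conj_op n" by auto
      with out obtain j where j: "js = [j]"
        by (auto elim!: cyc_conj_op.elims)
      let ?w = "out_of (\<tau> ! j)"
      have "out = drop n ?w @ take n ?w" using out n j by (auto split: if_splits)
      moreover have "corolla_cost (take n ?w @ drop n ?w) (g j)" using g j by simp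
      ultimately show ?thesis using rotate j by simp
    qed
  qed (rule base)
  then show ?thesis by (simp add: eta_sla_def sum_list_triv)
qed

lemma sla_of_corolla_cost:
  assumes "corolla_cost c n"
  shows "\<exists>\<tau>. sla_Rbar X R \<tau> \<and> result \<tau> = c \<and> eta_sla \<tau> = n"
  using assms
proof induction
  case (base r)
  then have "sla_Rbar X R [Base r]"
    using R_words R_cyc by (auto simp: sla_Rbar_def intro!: sla_Base)
  then show ?case by (intro exI[of _ "[Base r]"]) (simp add: result_def eta_sla_def)
next
  case (rotate u v n)
  then obtain \<tau> where \<tau>: "sla_Rbar X R \<tau>" "result \<tau> = u @ v" "eta_sla \<tau> = n" by blast
  let ?\<tau> = "\<tau> @ [Apply (cyc_conj_op (length u)) [length \<tau> - 1] (v @ u)]"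
  have sla: "sla {w \<in> words X. cyc_reduced w} R (insert cyc_prod_op (range cyc_conj_op)) \<tau>"
    using \<tau>(1) by (simp add: sla_Rbar_def)
  have "v @ u \<in> words X" "cyc_reduced (v @ u)"
    using corolla_cost_props[OF rotate(1)] by (auto intro: cyc_reduced_rotate)
  then have "sla {w \<in> words X. cyc_reduced w} R (insert cyc_prod_op (range cyc_conj_op)) ?\<tau>"
    using \<tau>(2) by (intro sla_Apply1[OF sla]) auto
  moreover have "out \<noteq> [] \<and> length out < length (out_of (?\<tau> ! j)) + length (out_of (?\<tau> ! k))"
    if i: "i < length ?\<tau>" "?\<tau> ! i = Apply cyc_prod_op [j, k] out" for i j k out
  proof -
    \<comment> \<open>The added rotation has one input and not two, so a product step is an old
      one.\<close>
    have i': "i < length \<tau>" using i by (cases "i = length \<tau>") auto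
    then have eq: "\<tau> ! i = Apply cyc_prod_op [j, k] out" using i by (simp add: nth_append)
    then have "j < i" "k < i" using sla_inputs[OF sla i'] by auto
    then show ?thesis using \<tau>(1) i' eq unfolding sla_Rbar_def by (simp add: nth_append)
  qed
  ultimately have "sla_Rbar X R ?\<tau>" unfolding sla_Rbar_def by blast
  then show ?case using \<tau> by (intro exI[of _ ?\<tau>]) (simp add: result_def eta_sla_def)
next
  case (prod u m v n)
  then obtain \<tau> \<tau>' where \<tau>: "sla_Rbar X R \<tau>" "result \<tau> = u" "eta_sla \<tau> = m"
    and \<tau>': "sla_Rbar X R \<tau>'" "result \<tau>' = v" "eta_sla \<tau>' = n" by blast
  let ?U = "{w \<in> words X. cyc_reduced w}" and ?\<Phi> = "insert cyc_prod_op (range cyc_conj_op)"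
  let ?\<tau> = "join_sla cyc_prod_op (cyc_prod u v) \<tau> \<tau>'"
  have sla: "sla ?U R ?\<Phi> \<tau>" and sla': "sla ?U R ?\<Phi> \<tau>'"
    using \<tau>(1) \<tau>'(1) by (simp_all add: sla_Rbar_def)
  have ne: "\<tau> \<noteq> []" "\<tau>' \<noteq> []" using sla sla' by (simp_all add: sla_def)
  have "cyc_prod u v \<in> ?U"
    using corolla_cost_props[OF corolla_cost.prod[OF prod.hyps]] by simp
  then have "sla ?U R ?\<Phi> ?\<tau>"
    using \<tau>(2) \<tau>'(2) by (intro sla_join_sla sla sla') auto
  moreover have "out \<noteq> [] \<and> length out < length (out_of (?\<tau> ! j)) + length (out_of (?\<tau> ! k))"
    if i: "i < length ?\<tau>" "?\<tau> ! i = Apply cyc_prod_op [j, k] out" for i j k out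
    using i(1)
  proof (cases rule: join_sla_cases)
    case 1
    then have eq: "\<tau> ! i = Apply cyc_prod_op [j, k] out" using i by (simp add: nth_join_sla)
    then have "j < i" "k < i" using sla_inputs[OF sla 1] by auto
    then show ?thesis using \<tau>(1) 1 eq unfolding sla_Rbar_def by (simp add: nth_join_sla)
  next
    case (2 l)
    then have "shift_step (length \<tau>) (\<tau>' ! l) = Apply cyc_prod_op [j, k] out"
      using i by (simp add: nth_join_sla)
    then obtain j' k' where eq: "\<tau>' ! l = Apply cyc_prod_op [j', k'] out"
      and jk: "j = length \<tau> + j'" "k = length \<tau> + k'"
      by (cases "\<tau>' ! l") auto
    then have "j' < l" "k' < l" using sla_inputs[OF sla' 2(1)] by auto
    then show ?thesis using \<tau>'(1) 2(1) eq jk unfolding sla_Rbar_def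
      by (simp add: nth_join_sla)
  next
    case 3
    have "?\<tau> ! (length \<tau> - 1) = last \<tau>"
      "?\<tau> ! (length \<tau> + length \<tau>' - 1) = shift_step (length \<tau>) (last \<tau>')"
      using nth_join_sla(1)[of "length \<tau> - 1" \<tau>] ne
        nth_join_sla(2)[of "length \<tau>' - 1" \<tau>' cyc_prod_op "cyc_prod u v" \<tau>]
      by (auto simp: last_conv_nth Suc_le_eq)
    then show ?thesis using i \<tau>(2) \<tau>'(2) prod.hyps(3,4) unfolding 3 nth_join_sla(3)
      by (auto simp: result_def)
  qed
  ultimately have "sla_Rbar X R ?\<tau>" unfolding sla_Rbar_def by blast
  moreover have "eta_sla ?\<tau> = m + n"
    using \<tau>(3) \<tau>'(3) by (simp add: eta_sla_def join_sla_def filter_map comp_def)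
  ultimately show ?case by (intro exI[of _ ?\<tau>]) simp
qed

lemma g_corolla_iff: "g_corolla X R c \<longleftrightarrow> (\<exists>n. corolla_cost c n)"
  unfolding g_corolla_def using corolla_cost_of_sla sla_of_corolla_cost by blast

lemma eta_eq: "eta X R c = (LEAST n. corolla_cost c n)"
proof -
  have "(\<exists>\<tau>. sla_Rbar X R \<tau> \<and> result \<tau> = c \<and> eta_sla \<tau> = n) \<longleftrightarrow> corolla_cost c n" for n
    using corolla_cost_of_sla sla_of_corolla_cost by blast
  then show ?thesis by (simp add: eta_def)
qed

lemma corolla_cost_eta: "g_corolla X R c \<Longrightarrow> corolla_cost c (eta X R c)"
  unfolding eta_eq g_corolla_iff by (rule LeastI_ex)

lemma eta_le: "corolla_cost c n \<Longrightarrow> eta X R c \<le> n"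
  unfolding eta_eq by (rule Least_le)

section \<open>Words generated by insertions: rotation and free reduction\<close>

text \<open>The empty word has every cost, so that \<open>insertion_cost w n\<close> means \<open>A(w) \<le> n\<close> for \<open>w \<noteq> 1\<close>.\<close>

inductive insertion_cost :: "'a word \<Rightarrow> nat \<Rightarrow> bool"
  where
    Nil: "insertion_cost [] n"
  | pair: "fst x \<in> X \<Longrightarrow> insertion_cost [x, inv_letter x] 0"
  | corolla: "corolla_cost c n \<Longrightarrow> insertion_cost c n"
  | insert: "insertion_cost (w1 @ w2) m \<Longrightarrow> insertion_cost u n \<Longrightarrow>
      insertion_cost (w1 @ u @ w2) (m + n)"

lemma insertion_cost_in_words: "insertion_cost w n \<Longrightarrow> w \<in> words X"
  by (induction rule: insertion_cost.induct) (auto dest: corolla_cost_props(1))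

text \<open>The empty word, appended at cost \<open>n - m\<close>, absorbs the difference.\<close>

lemma insertion_cost_mono:
  assumes "insertion_cost w m" "m \<le> n"
  shows "insertion_cost w n"
  using insert[of w "[]" m "[]" "n - m"] assms Nil by simp

lemma insertion_cost_append:
  assumes "insertion_cost u m" "insertion_cost v n"
  shows "insertion_cost (u @ v) (m + n)"
  using insert[of u "[]" m v n] assms by simp

text \<open>If \<open>x\<close> cancels against \<open>red u\<close>, inserting the pair of
  \<open>x\<close> and its inverse restores both letters; otherwise nothing was cancelled at
  \<open>x\<close>. The prefix \<open>p\<close> collects the letters already restored.\<close>

lemma insertion_cost_unreduce:
  assumes "insertion_cost (p @ red u) n" "u \<in> words X"
  shows "insertion_cost (p @ u) n"
  using assms
proof (induction u arbitrary: p)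
  case (Cons x u)
  have "insertion_cost ((p @ [x]) @ red u) n"
  proof (cases "\<exists>v. red u = inv_letter x # v")
    case True
    then obtain v where v: "red u = inv_letter x # v" by blast
    then have "insertion_cost (p @ v) n" using Cons(2) by simp
    from insert[OF this pair, of x] v show ?thesis using Cons(3) by simp
  next
    case False
    then have "red (x # u) = x # red u" by (cases "red u") auto
    then show ?thesis using Cons(2) by simp
  qed
  from Cons(1)[OF this] show ?case using Cons(3) by simp
qed simp

text \<open>Covers the base words \<open>v @ inv_word v\<close> of \<open>sla_Lg\<close>; of these
  only the ones with \<open>v\<close> a single letter are generators of
  \<open>insertion_cost\<close>.\<close>

lemma insertion_cost_trivial:
  assumes "u \<in> words X" "red u = []"
  shows "insertion_cost u n"
  using insertion_cost_unreduce[of "[]" u n] assms Nil by simp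

lemma insertion_cost_conj:
  assumes "insertion_cost u n" "t \<in> words X"
  shows "insertion_cost (t @ u @ inv_word t) n"
  using insert[of t "inv_word t" 0 u n] insertion_cost_trivial[of "t @ inv_word t" 0] assms
  by (simp add: inv_word_in_words red_append_inv_word)

text \<open>The cut falls before, inside or after the inserted word; only a cut inside changes the
  shape of the computation.\<close>

lemma insertion_cost_rotate:
  assumes "insertion_cost (u @ v) n"
  shows "insertion_cost (v @ u) n"
  using assms
proof (induction "u @ v" n arbitrary: u v rule: insertion_cost.induct)
  case (Nil n)
  then show ?case by (simp add: insertion_cost.Nil)
next
  case (pair x)
  then consider "u = []" | "v = []" | "u = [x]" "v = [inv_letter x]"
    by (auto simp: Cons_eq_append_conv)
  then show ?case
  proof cases
    case 3
    then show ?thesis using insertion_cost.pair[of "inv_letter x"] pair(1) by simp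
  qed (use insertion_cost.pair[of x] pair in simp_all)
next
  case (corolla n)
  then show ?case using rotate[of u v] insertion_cost.corolla by simp
next
  case (insert w1 w2 m y n)
  from insert(5) consider z where "w1 = u @ z" "v = z @ y @ w2"
    | a b where "y = a @ b" "u = w1 @ a" "v = b @ w2"
    | z where "w2 = z @ v" "u = w1 @ y @ z"
    by (auto simp: append_eq_append_conv2)
  then show ?case
  proof cases
    case 1
    then have "insertion_cost (z @ w2 @ u) m" using insert(2)[of u "z @ w2"] by simp
    from insertion_cost.insert[OF this insert(3)] show ?thesis using 1 by simp
  next
    case 2
    \<comment> \<open>Host and inserted word exchange roles: the rotated host \<open>w2 @ w1\<close>
      is inserted between \<open>b\<close> and \<open>a\<close>.\<close>
    then have "insertion_cost (b @ a) n" "insertion_cost (w2 @ w1) m"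
      using insert(2)[of w1 w2] insert(4) by auto
    from insertion_cost.insert[OF this] show ?thesis using 2 by (simp add: add.commute)
  next
    case 3
    then have "insertion_cost ((v @ w1) @ z) m" using insert(2)[of "w1 @ z" v] by simp
    from insertion_cost.insert[OF this insert(3)] show ?thesis using 3 by simp
  qed
qed

section \<open>Cancelling a pair of adjacent inverse letters\<close>

definition base_cost :: "'a word \<Rightarrow> nat \<Rightarrow> bool"
  where "base_cost b n \<longleftrightarrow> (\<exists>x. fst x \<in> X \<and> b = [x, inv_letter x]) \<or> corolla_cost b n"

lemma base_cost_Cons:
  "base_cost (x # b) n \<longleftrightarrow> fst x \<in> X \<and> b = [inv_letter x] \<or> corolla_cost (x # b) n"
  unfolding base_cost_def by (auto simp del: split_paired_Ex)

text \<open>The computed word seen from the base word that owns its first letter: everything else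
  lies in gaps, one after each letter of \<open>b\<close>. No gap is in front, so \<open>b\<close>
  and \<open>w\<close> begin alike.\<close>

inductive interleaved :: "'a word \<Rightarrow> 'a word \<Rightarrow> nat \<Rightarrow> bool"
  where
    Nil: "interleaved [] [] 0"
  | Cons: "insertion_cost v m \<Longrightarrow> interleaved b w n \<Longrightarrow>
      interleaved (x # b) (x # v @ w) (m + n)"

inductive_cases interleaved_ConsE: "interleaved b (x # w) n"

lemma base_cost_insertion_cost: "base_cost b n \<Longrightarrow> insertion_cost b n"
  using insertion_cost_mono[OF pair] by (auto simp: base_cost_def simp del: split_paired_Ex intro: corolla)

lemma interleaved_refl: "interleaved b b 0"
proof (induction b)
  case (Cons x b)
  from interleaved.Cons[OF insertion_cost.Nil[of 0] this, of x] show ?case by simp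
qed (rule interleaved.Nil)

text \<open>As \<open>w1\<close> is non-empty, the place of insertion is inside or at the border of
  a gap, which absorbs \<open>u\<close>.\<close>

lemma interleaved_insert:
  assumes "interleaved b (w1 @ w2) m" "insertion_cost u n" "w1 \<noteq> []"
  shows "interleaved b (w1 @ u @ w2) (m + n)"
  using assms(1,3)
proof (induction b "w1 @ w2" m arbitrary: w1 rule: interleaved.induct)
  case (Cons v m b w k x)
  then obtain z where z: "w1 = x # z" "v @ w = z @ w2" by (auto simp: Cons_eq_append_conv)
  \<comment> \<open>The border case is assigned to the gap \<open>v\<close>, so that
    \<open>y\<close> is non-empty in the second alternative, as the induction hypothesis
    requires.\<close>
  then consider y where "v = z @ y" "w2 = y @ w" | y where "z = v @ y" "w = y @ w2" "y \<noteq> []"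
    by (auto simp: append_eq_append_conv2) (metis append_Nil append_Nil2)
  then show ?case
  proof cases
    case 1
    then have "insertion_cost (z @ u @ y) (m + n)"
      using Cons(1) assms(2) by (auto intro: insertion_cost.insert)
    from interleaved.Cons[OF this Cons(2)] show ?thesis using z 1 by (simp add: ac_simps)
  next
    case 2
    from interleaved.Cons[OF Cons(1) Cons(3)[OF 2(2,3)]] show ?thesis
      using z 2 by (simp add: ac_simps)
  qed
qed simp

text \<open>Serves to fill the gaps of \<open>b\<close> after \<open>b\<close> has been joined to
  other words; \<open>p\<close> collects the part already filled.\<close>

lemma insertion_cost_interleaved:
  assumes "interleaved b w n" "insertion_cost (p @ b @ q) m"
  shows "insertion_cost (p @ w @ q) (m + n)"
  using assms
proof (induction arbitrary: p m rule: interleaved.induct)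
  case (Cons v k b w n x)
  have "insertion_cost ((p @ [x]) @ v @ b @ q) (m + k)"
    using Cons(1,4) by (intro insertion_cost.insert) auto
  then show ?case using Cons(3)[of "p @ x # v" "m + k"] by (simp add: ac_simps)
qed simp

text \<open>Follows the first letter down to the base word it comes from. The cost is only bounded,
  since an empty inserted word may carry a positive cost, which is lost.\<close>

lemma insertion_cost_decompose:
  assumes "insertion_cost w n" "w \<noteq> []"
  shows "\<exists>b k m. base_cost b k \<and> interleaved b w m \<and> k + m \<le> n"
  using assms
proof induction
  case (pair x)
  then show ?case
    by (intro exI[of _ "[x, inv_letter x]"] exI[of _ 0]) (auto simp: base_cost_Cons interleaved_refl)
next
  case (corolla c n)
  then show ?case
    by (intro exI[of _ c] exI[of _ n] exI[of _ 0]) (auto simp: base_cost_def interleaved_refl)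
next
  case (insert w1 w2 m u n)
  show ?case
  proof (cases "w1 = []")
    case False
    with insert obtain b k l where b: "base_cost b k" "interleaved b (w1 @ w2) l" "k + l \<le> m"
      by auto
    from interleaved_insert[OF b(2) insert(2) False] show ?thesis
      using b by (intro exI[of _ b] exI[of _ k] exI[of _ "l + n"]) auto
  next
    case w1: True
    show ?thesis
    proof (cases "u = []")
      case True
      with w1 insert obtain b k l where b: "base_cost b k" "interleaved b w2 l" "k + l \<le> m"
        by auto
      then show ?thesis using True w1
        by (intro exI[of _ b] exI[of _ k] exI[of _ l]) auto
    next
      case False
      with insert obtain b k l where b: "base_cost b k" "interleaved b u l" "k + l \<le> n"
        by auto
      \<comment> \<open>Now \<open>u\<close> provides the first letter, and the host
        \<open>w2\<close> goes into the gap after the last letter of \<open>b\<close>.\<close>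
      have "interleaved b (u @ w2 @ []) (l + m)"
        using b insert(1) w1 False by (intro interleaved_insert) auto
      then show ?thesis using b w1
        by (intro exI[of _ b] exI[of _ k] exI[of _ "l + m"]) auto
    qed
  qed
qed simp

text \<open>The cancelled letters make the product of \<open>b @ [x]\<close> and
  \<open>inv_letter x # d\<close> at least two letters shorter than its factors together, so a
  non-trivial product is a g. corolla. The order \<open>d @ b\<close> is that of a word inserted
  right after \<open>x\<close>.\<close>

lemma insertion_cost_merge:
  assumes "base_cost (x # b) m" "base_cost (inv_letter x # d) n"
  shows "insertion_cost (d @ b) (m + n)"
proof -
  have rot: "insertion_cost (b @ [x]) m" "insertion_cost (d @ [inv_letter x]) n"
    using assms[THEN base_cost_insertion_cost] insertion_cost_rotate[of "[_]"] by auto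
  \<comment> \<open>If one word is a pair of inverse letters, what remains is the other word up to
    rotation; two g. corollas need the product.\<close>
  consider "b = [inv_letter x]" | "d = [x]" | "corolla_cost (x # b) m" "corolla_cost (inv_letter x # d) n"
    using assms by (auto simp: base_cost_Cons)
  then show ?thesis
  proof cases
    case 1
    then show ?thesis using insertion_cost_mono[OF rot(2), of "m + n"] by simp
  next
    case 2
    then show ?thesis
      using insertion_cost_mono[OF insertion_cost_rotate[OF rot(1)], of "m + n"] by simp
  next
    case 3
    then have c: "corolla_cost (b @ [x]) m" using rotate[of "[x]" b] by simp
    let ?c = "cyc_prod (b @ [x]) (inv_letter x # d)"
    have red: "red ((b @ [x]) @ inv_letter x # d) = red (b @ d)"
      using red_append_cong[of b b "[x, inv_letter x] @ d" d] push_letter_cancel[OF reduced_red, of x d]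
      by simp
    obtain t where t: "red (b @ d) = t @ ?c @ inv_word t"
      using cyc_red_form_props(2)[of "(b @ [x]) @ inv_letter x # d"] red by (auto simp: cyc_prod_def)
    have bd: "b @ d \<in> words X"
      using corolla_cost_props(1)[OF 3(1)] corolla_cost_props(1)[OF 3(2)] by simp
    then have tw: "t \<in> words X" using red_in_words[OF bd] t by simp
    have "insertion_cost ?c (m + n)"
    proof (cases "?c = []")
      case True
      then show ?thesis by (simp add: insertion_cost.Nil)
    next
      case False
      have "length ?c \<le> length (red (b @ d))" using t by simp
      also have "\<dots> \<le> length (b @ d)" by (rule length_red)
      finally show ?thesis using False c 3 by (intro corolla prod) auto
    qed
    then have "insertion_cost ([] @ red (b @ d)) (m + n)"
      unfolding t using tw by (auto intro: insertion_cost_conj)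
    from insertion_cost_unreduce[OF this bd] show ?thesis
      using insertion_cost_rotate by simp
  qed
qed

text \<open>Let \<open>b\<close> be the base word owning \<open>x\<close>. The inverse letter is
  either the next letter of \<open>b\<close>, or it starts the word \<open>v\<close> in the gap
  after \<open>x\<close> and belongs to another base word \<open>d\<close>.\<close>

lemma insertion_cost_cancel_Cons:
  assumes "insertion_cost (x # inv_letter x # w) n"
  shows "insertion_cost w n"
proof -
  obtain b k m where b: "base_cost b k" "interleaved b (x # inv_letter x # w) m" "k + m \<le> n"
    using insertion_cost_decompose[OF assms] by blast
  from b(2) obtain b' v w' m1 m2 where bv: "b = x # b'" "inv_letter x # w = v @ w'"
    "m = m1 + m2" "insertion_cost v m1" "interleaved b' w' m2"
    by (auto elim: interleaved_ConsE)
  show ?thesis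
  proof (cases v)
    case Nil
    with bv have "interleaved b' (inv_letter x # w) m2" by simp
    then obtain b'' v2 w2 n1 n2 where b'': "b' = inv_letter x # b''" "w = v2 @ w2"
      "m2 = n1 + n2" "insertion_cost v2 n1" "interleaved b'' w2 n2"
      by (auto elim: interleaved_ConsE)
    \<comment> \<open>A g. corolla is reduced, so here \<open>b\<close> is just the cancelled pair
      and \<open>w\<close> is the word in its last gap.\<close>
    have "\<not> corolla_cost b k"
      using corolla_cost_props(3)[of b k] bv(1) b''(1) by (auto simp: cyc_reduced_def reduced_Cons)
    then have "b'' = []" using b(1) bv(1) b''(1) by (auto simp: base_cost_Cons)
    then have "w2 = []" using b''(5) by (auto elim: interleaved.cases)
    then show ?thesis using b'' bv b by (auto intro: insertion_cost_mono)
  next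
    case (Cons y v')
    with bv(2) have v: "v = inv_letter x # v'" "w = v' @ w'" by auto
    obtain d l p where d: "base_cost d l" "interleaved d v p" "l + p \<le> m1"
      using insertion_cost_decompose[OF bv(4)] v by blast
    from d(2)[unfolded v] obtain d' u D p1 p2 where dd: "d = inv_letter x # d'" "v' = u @ D"
      "p = p1 + p2" "insertion_cost u p1" "interleaved d' D p2"
      by (auto elim: interleaved_ConsE)
    \<comment> \<open>The two base words are joined without the cancelled letters; then the gaps of
      \<open>d'\<close> and \<open>b'\<close> are filled, and \<open>u\<close>, from the gap after
      the inverse letter, is put in front.\<close>
    have "insertion_cost (d' @ b') (k + l)"
      using b(1) d(1) bv(1) dd(1) by (auto intro: insertion_cost_merge)
    then have "insertion_cost (D @ b') (k + l + p2)"
      using insertion_cost_interleaved[OF dd(5), of "[]" b'] by simp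
    then have "insertion_cost (D @ w') (k + l + p2 + m2)"
      using insertion_cost_interleaved[OF bv(5), of D "[]"] by simp
    from insertion_cost_append[OF dd(4) this] show ?thesis
      using v dd b d bv by (auto intro: insertion_cost_mono)
  qed
qed

text \<open>One rotation brings the pair to the front, and a second one restores the order.\<close>

lemma insertion_cost_cancel:
  assumes "insertion_cost (p @ x # inv_letter x # q) n"
  shows "insertion_cost (p @ q) n"
  using insertion_cost_rotate[of p "x # inv_letter x # q"] insertion_cost_rotate[of q p]
    insertion_cost_cancel_Cons[of x "q @ p"] assms by simp

lemma insertion_cost_reduce:
  assumes "insertion_cost (p @ u) n"
  shows "insertion_cost (p @ red u) n"
  using assms
proof (induction u arbitrary: p)
  case (Cons x u)
  then have *: "insertion_cost (p @ x # red u) n" using Cons(1)[of "p @ [x]"] by simp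
  show ?case
  proof (cases "\<exists>v. red u = inv_letter x # v")
    case True
    then show ?thesis using * insertion_cost_cancel[of p x] by auto
  next
    case False
    then have "red (x # u) = x # red u" by (cases "red u") auto
    then show ?thesis using * by simp
  qed
qed simp

section \<open>Insertion costs and the function A\<close>

lemma A_sla_eq:
  "A_sla X R \<sigma> =
    (\<Sum>s\<leftarrow>filter is_Base \<sigma>. if g_corolla X R (out_of s) then eta X R (out_of s) else 0)"
  unfolding A_sla_def by (induction \<sigma>) auto

lemma insertion_cost_of_sla:
  assumes "sla_Lg X R \<sigma>"
  shows "insertion_cost (result \<sigma>) (A_sla X R \<sigma>)"
  unfolding A_sla_eq
  using assms[unfolded sla_Lg_def]
proof (rule sla_cost_induct)
  fix b
  assume b: "b \<in> {v @ inv_word v | v. v \<in> words X \<and> reduced v \<and> v \<noteq> []} \<union> {c. g_corolla X R c}"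
  show "insertion_cost b (if g_corolla X R b then eta X R b else 0)"
  proof (cases "g_corolla X R b")
    case True
    then show ?thesis by (simp add: corolla corolla_cost_eta)
  next
    case False
    with b obtain v where "v \<in> words X" "b = v @ inv_word v" by auto
    then show ?thesis
      using False by (simp add: insertion_cost_trivial inv_word_in_words red_append_inv_word)
  qed
next
  fix i f js out g
  assume i: "i < length \<sigma>" "\<sigma> ! i = Apply f js out"
    and g: "\<And>j. j \<in> set js \<Longrightarrow> insertion_cost (out_of (\<sigma> ! j)) (g j)"
  from assms i have "f \<in> range insert_op"
    and js: "distinct js" and out: "f (map (\<lambda>j. out_of (\<sigma> ! j)) js) = Some out"
    by (auto simp: sla_Lg_def sla_def split: step.splits)
  then obtain n where f: "f = insert_op n" by blast
  from f out obtain j k where jk: "js = [j, k]" by (auto elim!: insert_op.elims)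
  let ?w = "out_of (\<sigma> ! j)"
  have "out = take n ?w @ out_of (\<sigma> ! k) @ drop n ?w" using out f jk by (auto split: if_splits)
  moreover have "insertion_cost (take n ?w @ drop n ?w) (g j)" "insertion_cost (out_of (\<sigma> ! k)) (g k)"
    using g jk by simp_all
  ultimately show "insertion_cost out (sum g (set js))" using insert js jk by simp
qed

lemma sla_Lg_corolla:
  assumes "g_corolla X R c"
  shows "sla_Lg X R [Base c]" "A_sla X R [Base c] = eta X R c"
  using assms corolla_cost_props(1) unfolding sla_Lg_def
  by (auto simp: g_corolla_iff A_sla_def intro!: sla_Base)

text \<open>No SLA in the sense of \<open>sla_Lg\<close> computes the empty word, so insertions with
  an empty host or an empty inserted word are dropped instead of becoming steps. This, and corolla
  costs above \<open>eta\<close>, leave only an inequality.\<close>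

lemma sla_of_insertion_cost:
  assumes "insertion_cost w n" "w \<noteq> []"
  shows "\<exists>\<sigma>. sla_Lg X R \<sigma> \<and> result \<sigma> = w \<and> A_sla X R \<sigma> \<le> n"
  using assms
proof induction
  case (pair x)
  have "sla_Lg X R [Base ([x] @ inv_word [x])]"
    unfolding sla_Lg_def using pair
    by (intro sla_Base UnI1 CollectI exI[of _ "[x]"]) (auto simp: reduced_Cons inv_word_Cons)
  \<comment> \<open>This word is not reduced, hence no g. corolla, and adds nothing to
    \<open>A_sla\<close>.\<close>
  moreover have "\<not> g_corolla X R [x, inv_letter x]"
    using corolla_cost_props(3) by (force simp: g_corolla_iff cyc_reduced_def reduced_Cons)
  ultimately show ?case
    by (intro exI[of _ "[Base [x, inv_letter x]]"]) (simp add: inv_word_Cons result_def A_sla_def)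
next
  case (corolla c n)
  then have "g_corolla X R c" by (auto simp: g_corolla_iff)
  then show ?case using sla_Lg_corolla[of c] eta_le[OF corolla.hyps]
    by (intro exI[of _ "[Base c]"]) (simp add: result_def)
next
  case (insert w1 w2 m u n)
  consider "w1 @ w2 = []" | "u = []" | "w1 @ w2 \<noteq> []" "u \<noteq> []" by blast
  then show ?case
  proof cases
    case 1
    then show ?thesis using insert by (metis append_Nil append_Nil2 append_is_Nil_conv trans_le_add2)
  next
    case 2
    then show ?thesis using insert by (metis append_Nil trans_le_add1)
  next
    case 3
    with insert obtain \<sigma> \<sigma>' where \<sigma>: "sla_Lg X R \<sigma>" "result \<sigma> = w1 @ w2" "A_sla X R \<sigma> \<le> m"
      and \<sigma>': "sla_Lg X R \<sigma>'" "result \<sigma>' = u" "A_sla X R \<sigma>' \<le> n" by blast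
    let ?\<sigma> = "join_sla (insert_op (length w1)) (w1 @ u @ w2) \<sigma> \<sigma>'"
    have "w1 @ u @ w2 \<in> words X"
      using insertion_cost_in_words[OF insert.hyps(1)] insertion_cost_in_words[OF insert.hyps(2)] by simp
    then have "sla_Lg X R ?\<sigma>"
      using \<sigma>(1,2) \<sigma>'(1,2) unfolding sla_Lg_def by (intro sla_join_sla) auto
    moreover have "A_sla X R ?\<sigma> = A_sla X R \<sigma> + A_sla X R \<sigma>'"
      by (simp add: A_sla_def join_sla_def filter_map comp_def)
    ultimately show ?thesis using \<sigma>(3) \<sigma>'(3) by (intro exI[of _ ?\<sigma>]) simp
  qed
qed simp

lemma A_word_le:
  assumes "insertion_cost w n" "w \<noteq> []"
  shows "A_word X R w \<le> n"
proof -
  obtain \<sigma> where "sla_Lg X R \<sigma>" "result \<sigma> = w" "A_sla X R \<sigma> \<le> n"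
    using sla_of_insertion_cost[OF assms] by blast
  then show ?thesis unfolding A_word_def
    by (intro order.trans[OF Least_le[of _ "A_sla X R \<sigma>"]]) auto
qed

lemma insertion_cost_A_word:
  assumes "insertion_cost w n" "w \<noteq> []"
  shows "insertion_cost w (A_word X R w)"
proof -
  have "\<exists>m \<sigma>. sla_Lg X R \<sigma> \<and> result \<sigma> = w \<and> A_sla X R \<sigma> = m"
    using sla_of_insertion_cost[OF assms] by blast
  from LeastI_ex[OF this] show ?thesis
    unfolding A_word_def[symmetric] using insertion_cost_of_sla by metis
qed

text \<open>Both \<open>A_word X R c\<close> and \<open>eta X R c\<close> are insertion costs of
  \<open>c\<close> and at most \<open>n\<close>, so minimality makes them equal to
  \<open>n\<close>.\<close>

lemma minimal_corolla_proper:
  assumes c: "corolla_cost c n" and min: "\<And>k. insertion_cost c k \<Longrightarrow> n \<le> k"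
  shows "proper_g_corolla X R c" "eta X R c = n"
proof -
  have g: "g_corolla X R c" using c by (auto simp: g_corolla_iff)
  show e: "eta X R c = n"
    using min[OF corolla[OF corolla_cost_eta[OF g]]] eta_le[OF c] by simp
  have "A_word X R c = n"
    using A_word_le[OF corolla[OF c]] min insertion_cost_A_word[OF corolla[OF c]]
      corolla_cost_props(2)[OF c] by (simp add: order.antisym)
  then show "proper_g_corolla X R c" using g e by (simp add: proper_g_corolla_def)
qed

text \<open>The inserted word of the last step is a subword of the result, and it is computed with
  minimal cost if the result is; descending along inserted words therefore ends at a base word.\<close>

lemma reduced_has_proper_corolla:
  assumes "insertion_cost w n" "w \<noteq> []" "reduced w" "\<And>k. insertion_cost w k \<Longrightarrow> n \<le> k"
  shows "\<exists>c. sublist c w \<and> proper_g_corolla X R c \<and> eta X R c \<le> n"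
  using assms
proof induction
  case (pair x)
  then show ?case by (simp add: reduced_Cons)
next
  case (corolla c n)
  then show ?case using minimal_corolla_proper[of c n] by auto
next
  case (insert w1 w2 m u n)
  show ?case
  proof (cases "u = []")
    case True
    then have "m \<le> k" if "insertion_cost (w1 @ w2) k" for k
      using insert.prems(3)[of k] that by simp
    then show ?thesis using insert True by (metis append_Nil trans_le_add1)
  next
    case False
    \<comment> \<open>A cheaper computation of \<open>u\<close> would give a cheaper one of the
      whole word.\<close>
    have "n \<le> k" if "insertion_cost u k" for k
      using insert.prems(3)[OF insertion_cost.insert[OF insert.hyps(1) that]] by simp
    then obtain c where c: "sublist c u" "proper_g_corolla X R c" "eta X R c \<le> n"
      using insert.IH(2) insert.prems(2) False by (auto simp: reduced_append)
    have "sublist c (w1 @ u @ w2)"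
      using c(1) by (meson sublist_appendI sublist_order.order_trans)
    then show ?thesis using c by (intro exI[of _ c]) auto
  qed
qed simp

section \<open>Products of conjugates\<close>

definition conj_concat :: "('a word \<times> 'a word) list \<Rightarrow> 'a word"
  where "conj_concat ps = concat (map (\<lambda>(t, r). t @ r @ inv_word t) ps)"

text \<open>Conjugators are arbitrary words and equality is taken after reduction, so products can
  be handled without reducing at each step; \<open>area_eq\<close> returns to reduced
  conjugators.\<close>

definition conj_prod :: "'a word \<Rightarrow> nat \<Rightarrow> bool"
  where "conj_prod w n \<longleftrightarrow> (\<exists>ps. length ps = n \<and> (\<forall>(t, r) \<in> set ps. t \<in> words X \<and> r \<in> R) \<and>
    red w = red (conj_concat ps))"

lemma conj_concat_Nil [simp]: "conj_concat [] = []"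
  by (simp add: conj_concat_def)

lemma conj_concat_Cons [simp]:
  "conj_concat ((t, r) # ps) = t @ r @ inv_word t @ conj_concat ps"
  by (simp add: conj_concat_def)

lemma conj_concat_append [simp]: "conj_concat (ps @ qs) = conj_concat ps @ conj_concat qs"
  by (simp add: conj_concat_def)

lemma conj_prod_cong: "conj_prod u n \<Longrightarrow> red u = red v \<Longrightarrow> conj_prod v n"
  by (simp add: conj_prod_def)

lemma conj_prod_Nil: "conj_prod [] 0"
  by (simp add: conj_prod_def)

lemma conj_prod_base: "r \<in> R \<Longrightarrow> conj_prod r 1"
  unfolding conj_prod_def by (intro exI[of _ "[([], r)]"]) simp

lemma conj_prod_append:
  assumes "conj_prod u m" "conj_prod v n"
  shows "conj_prod (u @ v) (m + n)"
proof -
  from assms obtain ps qs where "length ps = m" "\<forall>(t, r) \<in> set ps. t \<in> words X \<and> r \<in> R"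
    "red u = red (conj_concat ps)" "length qs = n" "\<forall>(t, r) \<in> set qs. t \<in> words X \<and> r \<in> R"
    "red v = red (conj_concat qs)"
    unfolding conj_prod_def by blast
  then show ?thesis unfolding conj_prod_def
    by (intro exI[of _ "ps @ qs"]) (auto intro: red_append_cong)
qed

lemma red_conj_concat_conj:
  "red (conj_concat (map (\<lambda>(t, r). (s @ t, r)) ps)) = red (s @ conj_concat ps @ inv_word s)"
proof (induction ps)
  case (Cons p ps)
  obtain t r where p: "p = (t, r)" by (cases p)
  let ?a = "s @ t @ r @ inv_word t" and ?c = "conj_concat ps @ inv_word s"
  have "red (conj_concat (map (\<lambda>(t, r). (s @ t, r)) (p # ps))) = red (?a @ inv_word s @ s @ ?c)"
    using red_append_cong[OF refl Cons, of "?a @ inv_word s"] by (simp add: p)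
  also have "\<dots> = red (?a @ ?c)"
    by (intro red_append_cong refl red_cancel_inv)
  finally show ?case by (simp add: p)
qed (simp add: red_append_inv_word)

lemma conj_prod_conj:
  assumes "conj_prod u n" "s \<in> words X"
  shows "conj_prod (s @ u @ inv_word s) n"
proof -
  from assms(1) obtain ps where ps: "length ps = n" "\<forall>(t, r) \<in> set ps. t \<in> words X \<and> r \<in> R"
    "red u = red (conj_concat ps)" unfolding conj_prod_def by blast
  have "red (s @ u @ inv_word s) = red (s @ conj_concat ps @ inv_word s)"
    by (intro red_append_cong refl ps(3))
  then show ?thesis unfolding conj_prod_def using ps(1,2) assms(2)
    by (intro exI[of _ "map (\<lambda>(t, r). (s @ t, r)) ps"]) (auto simp: red_conj_concat_conj)
qed

lemma inv_word_conj_concat: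
  "inv_word (conj_concat ps) = conj_concat (rev (map (\<lambda>(t, r). (t, inv_word r)) ps))"
  by (induction ps) auto

text \<open>The inverse of a conjugate of \<open>r\<close> is a conjugate of
  \<open>inv_word r\<close>, which lies in \<open>R\<close> by symmetry.\<close>

lemma conj_prod_inv_word:
  assumes "conj_prod u n"
  shows "conj_prod (inv_word u) n"
proof -
  from assms obtain ps where ps: "length ps = n" "\<forall>(t, r) \<in> set ps. t \<in> words X \<and> r \<in> R"
    "red u = red (conj_concat ps)" unfolding conj_prod_def by blast
  let ?qs = "rev (map (\<lambda>(t, r). (t, inv_word r)) ps)"
  have "\<forall>(t, r) \<in> set ?qs. t \<in> words X \<and> r \<in> R" using ps(2) R_inv by fastforce
  then show ?thesis unfolding conj_prod_def using red_inv_word_cong[OF ps(3)] ps(1)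
    by (intro exI[of _ ?qs]) (simp add: inv_word_conj_concat)
qed

text \<open>Rotation and passage to the cyclically reduced form are conjugations and keep the number
  of factors; hence the area of a g. corolla is at most its \<open>eta\<close>.\<close>

lemma corolla_cost_conj_prod:
  assumes "corolla_cost c n"
  shows "conj_prod c n"
  using assms
proof induction
  case (base r)
  then show ?case by (rule conj_prod_base)
next
  case (rotate u v n)
  have "conj_prod (inv_word u @ (u @ v) @ inv_word (inv_word u)) n"
    using rotate corolla_cost_props(1)[OF rotate(1)]
    by (intro conj_prod_conj) (simp_all add: inv_word_in_words)
  then show ?case by (rule conj_prod_cong) (simp add: red_cancel_inv)
next
  case (prod u m v n)
  obtain t where t: "red (u @ v) = t @ cyc_prod u v @ inv_word t"
    using cyc_red_form_props(2)[of "u @ v"] by (auto simp: cyc_prod_def)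
  have "red (u @ v) \<in> words X"
    using corolla_cost_props(1)[OF prod.hyps(1)] corolla_cost_props(1)[OF prod.hyps(2)]
    by (intro red_in_words) simp
  then have "t \<in> words X" by (simp add: t)
  then have "conj_prod (inv_word t @ (u @ v) @ inv_word (inv_word t)) (m + n)"
    using prod.IH by (intro conj_prod_conj conj_prod_append) (auto simp: inv_word_in_words)
  moreover have "red (inv_word t @ (u @ v) @ inv_word (inv_word t)) = red (cyc_prod u v)"
  proof -
    have "red (inv_word t @ (u @ v) @ t) = red (inv_word t @ red (u @ v) @ t)"
      by (intro red_append_cong refl) simp
    also have "\<dots> = red (cyc_prod u v @ inv_word t @ t)"
      by (simp add: t red_cancel_inv)
    also have "\<dots> = red (cyc_prod u v)"
      using red_append_cong[OF refl, of "inv_word t @ t" "[]" "cyc_prod u v"]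
      by (simp add: red_inv_word_append)
    finally show ?thesis by simp
  qed
  ultimately show ?case by (rule conj_prod_cong)
qed

section \<open>Area and the normal closure\<close>

lemma red_conj_concat_red:
  "red (conj_concat (map (\<lambda>(t, r). (red t, r)) ps)) = red (conj_concat ps)"
  by (induction ps) (auto intro!: red_append_cong red_inv_word_cong)

text \<open>Reducing the conjugators keeps the number of factors and the reduced product, so
  arbitrary words and elements of the free group give the same minimum.\<close>

lemma area_eq:
  assumes "reduced w"
  shows "area X R w = (LEAST n. conj_prod w n)"
proof -
  have "(\<exists>ps. length ps = n \<and>
    (\<forall>(t, r) \<in> set ps. t \<in> carrier (free_group X) \<and> r \<in> R) \<and>
    w = red (concat (map (\<lambda>(t, r). t @ r @ inv_word t) ps))) \<longleftrightarrow> conj_prod w n" (is "?L \<longleftrightarrow> _") for n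
  proof
    assume ?L
    then show "conj_prod w n"
      unfolding conj_prod_def conj_concat_def by (fastforce simp: free_group_def)
  next
    assume "conj_prod w n"
    then obtain ps where "length ps = n" "\<forall>(t, r) \<in> set ps. t \<in> words X \<and> r \<in> R"
      "red w = red (conj_concat ps)" unfolding conj_prod_def by blast
    then show ?L
      using red_reduced[OF assms] red_conj_concat_red[of ps] unfolding conj_concat_def
      by (intro exI[of _ "map (\<lambda>(t, r). (red t, r)) ps"])
        (auto simp: free_group_def reduced_red red_in_words)
  qed
  then show ?thesis by (simp add: area_def)
qed

lemma insertion_cost_conj_concat:
  assumes "\<forall>(t, r) \<in> set ps. t \<in> words X \<and> r \<in> R"
  shows "insertion_cost (conj_concat ps) (length ps)"
  using assms
proof (induction ps)
  case (Cons p ps)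
  obtain t r where p: "p = (t, r)" by (cases p)
  have "insertion_cost (t @ r @ inv_word t) 1"
    using Cons(2) p by (intro insertion_cost_conj corolla base) auto
  from insertion_cost_append[OF this Cons(1)] show ?case using Cons(2) p by simp
qed (simp add: insertion_cost.Nil)

lemma conj_prod_insertion_cost:
  assumes "conj_prod w n" "reduced w"
  shows "insertion_cost w n"
  using assms insertion_cost_conj_concat insertion_cost_reduce[of "[]"]
  unfolding conj_prod_def by (metis append_Nil red_reduced)

text \<open>The elements that are products of conjugates form a normal subgroup containing
  \<open>R\<close>, which therefore contains the normal closure. Hence the minimum defining the area
  of a relator is attained.\<close>

lemma relator_conj_prod:
  assumes "relator X R w"
  shows "reduced w" "\<exists>n. conj_prod w n"
proof -
  let ?G = "free_group X"
  let ?N = "{w \<in> carrier ?G. \<exists>n. conj_prod w n}"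
  interpret G: group ?G by (rule group_free_group)
  have inv: "inv\<^bsub>?G\<^esub> u = red (inv_word u)" if "u \<in> carrier ?G" for u
    using that
    by (intro G.inv_equality) (auto simp: free_group_def red_red_append red_inv_word_append
        reduced_red red_in_words inv_word_in_words)
  have mult: "u \<otimes>\<^bsub>?G\<^esub> v = red (u @ v)" for u v by (simp add: free_group_def)
  have prod: "\<exists>n. conj_prod (red (u @ v)) n" if "conj_prod u m" "conj_prod v n" for u v m n
    using conj_prod_cong[OF conj_prod_append[OF that]] by (metis red_red)
  have "subgroup ?N ?G"
  proof (rule G.subgroupI)
    show "?N \<noteq> {}" using conj_prod_Nil by (force simp: free_group_def)
    show "inv\<^bsub>?G\<^esub> u \<in> ?N" if "u \<in> ?N" for u
    proof -
      from that obtain n where u: "u \<in> carrier ?G" "conj_prod u n" by blast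
      have "conj_prod (red (inv_word u)) n"
        using conj_prod_cong[OF conj_prod_inv_word[OF u(2)]] by simp
      then show ?thesis using inv[OF u(1)] G.inv_closed[OF u(1)] by auto
    qed
    show "u \<otimes>\<^bsub>?G\<^esub> v \<in> ?N" if "u \<in> ?N" "v \<in> ?N" for u v
      using that prod[of u _ v] G.m_closed[of u v] by (auto simp: mult)
  qed auto
  moreover have "s \<otimes>\<^bsub>?G\<^esub> u \<otimes>\<^bsub>?G\<^esub> inv\<^bsub>?G\<^esub> s \<in> ?N" if s: "s \<in> carrier ?G" and "u \<in> ?N" for s u
  proof -
    from that obtain n where u: "u \<in> carrier ?G" "conj_prod u n" by blast
    have "s \<in> words X" using s by (simp add: free_group_def)
    from conj_prod_conj[OF u(2) this]
    have "conj_prod (s \<otimes>\<^bsub>?G\<^esub> u \<otimes>\<^bsub>?G\<^esub> inv\<^bsub>?G\<^esub> s) n"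
      by (rule conj_prod_cong) (simp add: mult inv[OF s] red_append_red red_red_append)
    then show ?thesis using s u by auto
  qed
  ultimately have "?N \<lhd> ?G" by (auto simp: G.normal_inv_iff)
  moreover have "R \<subseteq> ?N"
    using R_words R_cyc conj_prod_base by (fastforce simp: free_group_def cyc_reduced_def)
  ultimately have "w \<in> ?N" using assms unfolding relator_def normal_closure_def by blast
  then show "reduced w" "\<exists>n. conj_prod w n" by (auto simp: free_group_def)
qed

lemma conj_prod_area:
  assumes "reduced w" "conj_prod w n"
  shows "conj_prod w (area X R w)"
  unfolding area_eq[OF assms(1)] using assms(2) by (rule LeastI)

lemma area_le:
  assumes "reduced w" "conj_prod w n"
  shows "area X R w \<le> n"
  unfolding area_eq[OF assms(1)] using assms(2) by (rule Least_le)

section \<open>Existence and finiteness of the proper g. corollas\<close>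

theorem relator_has_proper_corolla:
  assumes "relator X R w" "w \<noteq> []"
  shows "\<exists>c. sublist c w \<and> proper_g_corolla X R c \<and> area X R c \<le> area X R w"
proof -
  have w: "reduced w" "insertion_cost w (area X R w)"
    using relator_conj_prod[OF assms(1)] conj_prod_area conj_prod_insertion_cost by blast+
  \<comment> \<open>This is A(w), expressed through \<open>insertion_cost\<close> to have minimality
    in the form needed below.\<close>
  define n where "n = (LEAST n. insertion_cost w n)"
  have n: "insertion_cost w n" "n \<le> area X R w" "\<And>k. insertion_cost w k \<Longrightarrow> n \<le> k"
    unfolding n_def using w(2) by (auto intro: LeastI Least_le)
  obtain c where c: "sublist c w" "proper_g_corolla X R c" "eta X R c \<le> n"
    using reduced_has_proper_corolla[OF n(1) assms(2) w(1) n(3)] by blast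
  then have cc: "corolla_cost c (eta X R c)"
    by (intro corolla_cost_eta) (simp add: proper_g_corolla_def)
  then have "area X R c \<le> eta X R c"
    using corolla_cost_props(3)[OF cc] corolla_cost_conj_prod
    by (intro area_le) (auto simp: cyc_reduced_def)
  with c n(2) show ?thesis by (intro exI[of _ c]) simp
qed

lemma length_corolla_cost:
  assumes "corolla_cost c n" "\<And>r. r \<in> R \<Longrightarrow> length r \<le> K"
  shows "length c \<le> n * K"
  using assms(1) by induction (use assms(2) in \<open>auto simp: algebra_simps\<close>)

theorem finite_proper_corollas:
  assumes "finite X" "finite R"
  shows "finite {c. proper_g_corolla X R c \<and> area X R c \<le> m}"
proof -
  \<comment> \<open>The element 0 keeps the maximum defined if \<open>R\<close> is empty.\<close>
  define K where "K = Max (insert 0 (length ` R))"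
  have K: "length r \<le> K" if "r \<in> R" for r
    unfolding K_def using assms(2) that by (intro Max_ge) auto
  have "c \<in> {c. set c \<subseteq> X \<times> UNIV \<and> length c \<le> m * K}"
    if "proper_g_corolla X R c" "area X R c \<le> m" for c
  proof -
    have cc: "corolla_cost c (eta X R c)" and A: "A_word X R c = eta X R c"
      using that(1) by (auto simp: proper_g_corolla_def corolla_cost_eta)
    have red: "reduced c" using corolla_cost_props(3)[OF cc] by (simp add: cyc_reduced_def)
    \<comment> \<open>The area bounds A from above, and properness turns this into a bound on
      \<open>eta\<close>, hence on the length.\<close>
    have "insertion_cost c (area X R c)"
      using conj_prod_area[OF red corolla_cost_conj_prod[OF cc]] red
      by (rule conj_prod_insertion_cost)
    then have "eta X R c \<le> m"
      using A_word_le[of c "area X R c"] corolla_cost_props(2)[OF cc] A that(2) by simp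
    then have "length c \<le> m * K"
      using length_corolla_cost[OF cc K] by (meson le_trans mult_le_mono1)
    then show ?thesis using corolla_cost_props(1)[OF cc] by (auto simp: words_def)
  qed
  then have "{c. proper_g_corolla X R c \<and> area X R c \<le> m} \<subseteq>
      {c. set c \<subseteq> X \<times> UNIV \<and> length c \<le> m * K}" by blast
  moreover have "finite {c :: 'a word. set c \<subseteq> X \<times> UNIV \<and> length c \<le> m * K}"
    using assms(1) by (intro finite_lists_length_le) simp
  ultimately show ?thesis by (rule finite_subset)
qed

end

theorem corollary4p1p3:
  fixes X :: "'a set" and R :: "'a word set"
  assumes "R \<subseteq> words X"
    and "\<forall>r \<in> R. r \<noteq> [] \<and> cyc_reduced r"
    and "inv_word ` R \<subseteq> R"
  shows "(\<forall>w m. relator X R w \<and> w \<noteq> [] \<and> area X R w = m \<longrightarrow>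
            (\<exists>c. sublist c w \<and> proper_g_corolla X R c \<and> area X R c \<le> m)) \<and>
         (finite X \<and> finite R \<longrightarrow>
            (\<forall>m. finite {c. proper_g_corolla X R c \<and> area X R c \<le> m}))"
proof -
  interpret symmetric_presentation X R using assms by unfold_locales
  show ?thesis using relator_has_proper_corolla finite_proper_corollas by blast
qed

end
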